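(* There are instances of the Graph Reconstruction problem (hidden graphs on $n$ vertices, for each $n$) that take $\Omega(n)$ MIS queries to solve but can be solved with $\mathcal{O}(\log n)$ CC queries.
   Context: Graph Reconstruction (GR): an unknown ("hidden") simple undirected graph $G=(V,E)$ on a known vertex set $V$ with $|V|=n$ is to be determined, i.e. the algorithm must output $E$, using oracle queries; complexity is the number of queries. A CC oracle, on query $S\subseteq V$, returns the partition of $S$ into the vertex sets of the connected components of the induced subgraph $G[S]$. A maximal independent set (MIS) oracle, on query $S\subseteq V$, returns some maximal independent set of $G[S]$, which may be chosen adversarially among all maximal independent sets of $G[S]$. *)

theory Defs
  imports Complex_Main "HOL-Library.Landau_Symbols"
begin

definition simple_graph :: "'v set \<Rightarrow> 'v set set \<Rightarrow> bool" where
  "simple_graph V E \<longleftrightarrow> finite V \<and> (\<forall>e\<in>E. e \<subseteq> V \<and> card e = 2)"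

definition induced_edges :: "'v set set \<Rightarrow> 'v set \<Rightarrow> 'v set set" where
  "induced_edges E S = {e \<in> E. e \<subseteq> S}"

definition adjacency :: "'v set set \<Rightarrow> ('v \<times> 'v) set" where
  "adjacency E = {(u, v). {u, v} \<in> E}"

definition components :: "'v set \<Rightarrow> 'v set set \<Rightarrow> 'v set set" where
  "components V E = V // ((adjacency E)\<^sup>* \<inter> V \<times> V)"

definition independent_set :: "'v set \<Rightarrow> 'v set set \<Rightarrow> 'v set \<Rightarrow> bool" where
  "independent_set V E I \<longleftrightarrow> I \<subseteq> V \<and> (\<forall>u\<in>I. \<forall>v\<in>I. {u, v} \<notin> E)"

definition maximal_independent_set :: "'v set \<Rightarrow> 'v set set \<Rightarrow> 'v set \<Rightarrow> bool" where
  "maximal_independent_set V E I \<longleftrightarrow>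
     independent_set V E I \<and> (\<forall>J. independent_set V E J \<and> I \<subseteq> J \<longrightarrow> J = I)"

text \<open>An oracle relates the hidden edge set and a query to the admissible answers.\<close>

type_synonym ('v, 'r) oracle_rel = "'v set set \<Rightarrow> 'v set \<Rightarrow> 'r \<Rightarrow> bool"

definition cc_oracle :: "('v, 'v set set) oracle_rel" where
  "cc_oracle E S P \<longleftrightarrow> P = components S (induced_edges E S)"

definition mis_oracle :: "('v, 'v set) oracle_rel" where
  "mis_oracle E S I \<longleftrightarrow> maximal_independent_set S (induced_edges E S) I"

text \<open>Deterministic adaptive query algorithms, as well-founded decision trees: the next query
  (or the final output, an edge set) depends on all the answers received so far.\<close>

datatype ('v, 'r) algorithm =
  Output "'v set set"
| Query "'v set" "'r \<Rightarrow> ('v, 'r) algorithm"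

primrec queries_within :: "'v set \<Rightarrow> ('v, 'r) algorithm \<Rightarrow> bool" where
  "queries_within V (Output F) \<longleftrightarrow> True"
| "queries_within V (Query S k) \<longleftrightarrow> S \<subseteq> V \<and> (\<forall>r. queries_within V (k r))"

text \<open>\<open>run orc E A q F\<close>: on the hidden edge set \<open>E\<close>, the algorithm \<open>A\<close> can make exactly \<open>q\<close> queries
  and then output \<open>F\<close>. Every answer may be any admissible one, independently of the earlier
  answers, so that quantifying over runs is quantifying over all (adaptive) adversaries.\<close>

inductive run ::
  "('v, 'r) oracle_rel \<Rightarrow> 'v set set \<Rightarrow> ('v, 'r) algorithm \<Rightarrow> nat \<Rightarrow> 'v set set \<Rightarrow> bool"
  for orc :: "('v, 'r) oracle_rel" and E :: "'v set set" where
  run_Output: "run orc E (Output F) 0 F"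
| run_Query: "orc E S r \<Longrightarrow> run orc E (k r) q F \<Longrightarrow> run orc E (Query S k) (Suc q) F"

text \<open>The algorithm has to be correct for every hidden graph on \<open>V\<close>. Both oracles have an
  admissible answer to every query inside the finite set \<open>V\<close>, and trees are well-founded, so
  runs always exist and the condition on outputs is total correctness.\<close>

definition solves_GR :: "('v, 'r) oracle_rel \<Rightarrow> 'v set \<Rightarrow> ('v, 'r) algorithm \<Rightarrow> bool" where
  "solves_GR orc V A \<longleftrightarrow> queries_within V A \<and>
     (\<forall>E. simple_graph V E \<longrightarrow> (\<forall>q F. run orc E A q F \<longrightarrow> F = E))"

definition uses_at_most ::
  "('v, 'r) oracle_rel \<Rightarrow> 'v set set \<Rightarrow> ('v, 'r) algorithm \<Rightarrow> nat \<Rightarrow> bool" where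
  "uses_at_most orc E A b \<longleftrightarrow> (\<forall>q F. run orc E A q F \<longrightarrow> q \<le> b)"

definition may_need_at_least ::
  "('v, 'r) oracle_rel \<Rightarrow> 'v set set \<Rightarrow> ('v, 'r) algorithm \<Rightarrow> nat \<Rightarrow> bool" where
  "may_need_at_least orc E A b \<longleftrightarrow> (\<exists>q F. run orc E A q F \<and> b \<le> q)"

text \<open>A family of instances: for every \<open>n\<close> a nonempty set of hidden graphs on \<open>{..<n}\<close>. Closure
  under relabelling of the vertices makes the labelling part of what is hidden: a family consisting
  of one labelled graph per \<open>n\<close> could be hardwired into the algorithm, which then only has to
  verify its guess.\<close>

definition instance_family :: "(nat \<Rightarrow> nat set set set) \<Rightarrow> bool" where
  "instance_family \<G> \<longleftrightarrow> (\<forall>n. \<G> n \<noteq> {} \<and> (\<forall>E\<in>\<G> n. simple_graph {..<n} E \<and>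
     (\<forall>\<pi>. bij_betw \<pi> {..<n} {..<n} \<longrightarrow> (\<lambda>e. \<pi> ` e) ` E \<in> \<G> n)))"

end

(* The witness is the family of stars.

   MIS lower bound: the adversary answers a query S by S minus the centre c whenever this is
   nonempty. Such an answer only shows that c has some neighbour in S, so it is compatible with
   the deletion of the edge {c, v} unless S = {c, v}. Hence each of the n - 1 edges has to be
   queried as a pair.

   CC upper bound: querying, for every bit position, the vertices with that bit set and those
   with that bit clear singles out the only star that the answers allow. Two more queries certify
   it: V - {c} has no edges, and V is connected, so that every other vertex is a neighbour of c.
   If the certificate fails, all pairs are queried. *)

theory Submission
  imports Defs "HOL-Real_Asymp.Real_Asymp"
begin

section \<open>Stars\<close>

definition star :: "nat \<Rightarrow> nat \<Rightarrow> nat set set" where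
  "star n c = (\<lambda>v. {c, v}) ` ({..<n} - {c})"

text \<open>For \<open>n = 0\<close> there is no centre, but a family has to be nonempty.\<close>

definition stars :: "nat \<Rightarrow> nat set set set" where
  "stars n = {star n c |c. n = 0 \<or> c < n}"

lemma simple_graph_star: "n = 0 \<or> c < n \<Longrightarrow> simple_graph {..<n} (star n c)"
  by (auto simp: simple_graph_def star_def)

lemma card_star: "n = 0 \<or> c < n \<Longrightarrow> card (star n c) = n - 1"
  unfolding star_def by (subst card_image) (auto simp: inj_on_def doubleton_eq_iff)

lemma mem_starD: "{u, v} \<in> star n c \<Longrightarrow> u \<noteq> v \<and> (u = c \<or> v = c)"
  unfolding star_def doubleton_eq_iff image_iff by blast

text \<open>A permutation takes the leaves at \<open>c\<close> to the leaves at
  \<open>\<pi> c\<close>, which yields the closure under relabelling.\<close>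

lemma image_star:
  assumes "bij_betw \<pi> {..<n} {..<n}" and "n = 0 \<or> c < n"
  shows "(\<lambda>e. \<pi> ` e) ` star n c = star n (\<pi> c)"
proof -
  have "\<pi> ` ({..<n} - {c}) = {..<n} - {\<pi> c}"
    using assms by (auto simp: bij_betw_def inj_on_def)
  then show ?thesis
    unfolding star_def by (simp add: image_image flip: image_image[of "\<lambda>v. {\<pi> c, v}" \<pi>])
qed

lemma instance_family_stars: "instance_family stars"
  unfolding instance_family_def
proof (intro allI conjI ballI impI)
  fix n
  show "stars n \<noteq> {}"
    by (auto simp: stars_def)
  fix E assume "E \<in> stars n"
  then obtain c where c: "n = 0 \<or> c < n" "E = star n c"
    by (auto simp: stars_def)
  then show "simple_graph {..<n} E"
    by (simp add: simple_graph_star)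
  fix \<pi> :: "nat \<Rightarrow> nat" assume \<pi>: "bij_betw \<pi> {..<n} {..<n}"
  have "n = 0 \<or> \<pi> c < n"
    using c \<pi> by (auto simp: bij_betw_def)
  then show "(\<lambda>e. \<pi> ` e) ` E \<in> stars n"
    unfolding stars_def using c image_star[OF \<pi> c(1)] by blast
qed

section \<open>The lower bound for MIS queries\<close>

text \<open>Answers that depend on the query alone select one branch of the tree, the same for every
  graph that admits them. One trace thus serves both the star and the star without an edge.\<close>

lemma trace_exists:
  "\<exists>qs F. (queries_within V A \<longrightarrow> set qs \<subseteq> Pow V) \<and>
     (\<forall>E. (\<forall>S\<in>set qs. orc E S (ans S)) \<longrightarrow> run orc E A (length qs) F)"
proof (induction A)
  case (Output F)
  then show ?case
    by (intro exI[of _ "[]"] exI[of _ F]) (auto intro: run_Output)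
next
  case (Query S k)
  obtain qs F where "queries_within V (k (ans S)) \<longrightarrow> set qs \<subseteq> Pow V"
    and "\<forall>E. (\<forall>S\<in>set qs. orc E S (ans S)) \<longrightarrow> run orc E (k (ans S)) (length qs) F"
    using Query[of "k (ans S)"] by auto
  then show ?case
    by (intro exI[of _ "S # qs"] exI[of _ F]) (auto intro: run_Query)
qed

text \<open>On \<open>{c}\<close> the empty set would not be maximal, so there the centre itself is
  the answer.\<close>

definition star_adversary :: "nat \<Rightarrow> nat set \<Rightarrow> nat set" where
  "star_adversary c S = (if S \<subseteq> {c} then S else S - {c})"

text \<open>Every edge contains \<open>c\<close>, so \<open>S - {c}\<close> is independent; when
  \<open>c\<close> is left out, its neighbour \<open>w\<close> prevents adding it. Allowing subsets
  of the star covers the deletion of an edge.\<close>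

lemma mis_oracle_star_adversary:
  assumes E: "E \<subseteq> star n c"
    and S: "S \<subseteq> {c} \<or> c \<notin> S \<or> (\<exists>w\<in>S. {c, w} \<in> E)"
  shows "mis_oracle E S (star_adversary c S)"
proof -
  let ?I = "star_adversary c S"
  have "independent_set S (induced_edges E S) ?I"
    unfolding independent_set_def
  proof (intro conjI ballI notI)
    show "?I \<subseteq> S"
      by (auto simp: star_adversary_def)
    fix u v assume uv: "u \<in> ?I" "v \<in> ?I" "{u, v} \<in> induced_edges E S"
    then have "u \<noteq> v \<and> (u = c \<or> v = c)"
      using E mem_starD unfolding induced_edges_def by blast
    then show False
      using uv by (auto simp: star_adversary_def split: if_splits)
  qed
  moreover have "J = ?I" if J: "independent_set S (induced_edges E S) J" "?I \<subseteq> J" for J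
  proof (cases "S \<subseteq> {c} \<or> c \<notin> S")
    case True
    then show ?thesis
      using J by (auto simp: star_adversary_def independent_set_def split: if_splits)
  next
    case False
    then obtain w where w: "w \<in> S" "{c, w} \<in> E"
      using S by blast
    then have "w \<noteq> c"
      using E mem_starD by blast
    then have "w \<in> J"
      using w False J by (auto simp: star_adversary_def)
    then have "c \<notin> J"
      using w J False by (auto simp: independent_set_def induced_edges_def)
    then show ?thesis
      using J False by (auto simp: star_adversary_def independent_set_def)
  qed
  ultimately show ?thesis
    by (auto simp: mis_oracle_def maximal_independent_set_def)
qed

lemma mis_lower_bound:
  assumes c: "n = 0 \<or> c < n" and A: "solves_GR mis_oracle {..<n} A"
  shows "may_need_at_least mis_oracle (star n c) A (n - 1)"
proof -
  obtain qs F where qs: "set qs \<subseteq> Pow {..<n}"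
    and run: "\<And>E. (\<forall>S\<in>set qs. mis_oracle E S (star_adversary c S)) \<Longrightarrow>
                run mis_oracle E A (length qs) F"
    using trace_exists[of "{..<n}" A mis_oracle "star_adversary c"] A
    unfolding solves_GR_def by blast
  have correct: "F = E" if "run mis_oracle E A (length qs) F" "simple_graph {..<n} E" for E
    using A that by (auto simp: solves_GR_def)
  have edge: "{c, w} \<in> star n c" if "S \<in> set qs" "w \<in> S" "w \<noteq> c" for S w
    using that qs by (auto simp: star_def)
  have run_star: "run mis_oracle (star n c) A (length qs) F"
  proof (rule run, rule ballI)
    fix S assume "S \<in> set qs"
    then have "S \<subseteq> {c} \<or> (\<exists>w\<in>S. {c, w} \<in> star n c)"
      using edge by blast
    then show "mis_oracle (star n c) S (star_adversary c S)"
      by (intro mis_oracle_star_adversary) auto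
  qed
  then have F: "F = star n c"
    using correct simple_graph_star c by blast
  \<comment> \<open>Edges and queries are both vertex sets, so this inclusion bounds the number of
    queries by counting edges.\<close>
  have "star n c \<subseteq> set qs"
  proof
    fix e assume e: "e \<in> star n c"
    show "e \<in> set qs"
    proof (rule ccontr)
      assume new: "e \<notin> set qs"
      let ?E = "star n c - {e}"
      obtain v where v: "e = {c, v}" "v \<noteq> c"
        using e by (auto simp: star_def)
      have "mis_oracle ?E S (star_adversary c S)" if S: "S \<in> set qs" for S
      proof (rule mis_oracle_star_adversary)
        show "S \<subseteq> {c} \<or> c \<notin> S \<or> (\<exists>w\<in>S. {c, w} \<in> ?E)"
        proof (rule ccontr)
          assume neg: "\<not> ?thesis"
          \<comment> \<open>By \<open>edge\<close>, a vertex of \<open>S\<close> other than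
            \<open>c\<close> and \<open>v\<close> would be joined to \<open>c\<close> in
            \<open>?E\<close>.\<close>
          then have "S - {c} \<subseteq> {v}"
            using edge[OF S] v by (auto simp: doubleton_eq_iff)
          then have "S = e"
            using neg v by blast
          then show False
            using S new by simp
        qed
      qed auto
      moreover have "simple_graph {..<n} ?E"
        using simple_graph_star[of n c] c by (auto simp: simple_graph_def)
      ultimately have "F = ?E"
        using run correct by blast
      then show False
        using F e by blast
    qed
  qed
  then have "card (star n c) \<le> length qs"
    by (meson List.finite_set card_length card_mono le_trans)
  then show ?thesis
    using run_star card_star[OF c] by (auto simp: may_need_at_least_def)
qed

section \<open>The upper bound for CC queries\<close>

definition cc_answer :: "'v set set \<Rightarrow> 'v set \<Rightarrow> 'v set set" where
  "cc_answer E S = components S (induced_edges E S)"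

lemma ex_cc_oracle: "(\<exists>r. cc_oracle E S r \<and> P r) \<longleftrightarrow> P (cc_answer E S)"
  by (simp add: cc_oracle_def cc_answer_def)

text \<open>Batches of queries fixed in advance: the algorithm adapts only between batches, and its
  cost is the sum of their lengths.\<close>

primrec ask :: "'v set list \<Rightarrow> ('r list \<Rightarrow> ('v, 'r) algorithm) \<Rightarrow> ('v, 'r) algorithm" where
  "ask [] k = k []"
| "ask (S # Ss) k = Query S (\<lambda>r. ask Ss (\<lambda>rs. k (r # rs)))"

inductive_simps run_Output_iff: "run orc E (Output F) q F'"
inductive_simps run_Query_iff: "run orc E (Query S k) q F"

lemma run_ask_cc:
  "run cc_oracle E (ask Ss k) q F \<longleftrightarrow>
     length Ss \<le> q \<and> run cc_oracle E (k (map (cc_answer E) Ss)) (q - length Ss) F"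
proof (induction Ss arbitrary: k q)
  case (Cons S Ss)
  show ?case
    by (cases q) (simp_all add: run_Query_iff Cons ex_cc_oracle)
qed simp

lemma queries_within_ask:
  "queries_within V (ask Ss k) \<longleftrightarrow>
     set Ss \<subseteq> Pow V \<and> (\<forall>rs. length rs = length Ss \<longrightarrow> queries_within V (k rs))"
  by (induction Ss arbitrary: k) (auto simp: length_Suc_conv)

lemma equiv_connected: "equiv S ((adjacency E)\<^sup>* \<inter> S \<times> S)"
proof (rule equivI)
  have "sym (adjacency E)"
    by (auto simp: adjacency_def sym_def insert_commute)
  then show "sym ((adjacency E)\<^sup>* \<inter> S \<times> S)"
    using sym_rtrancl[of "adjacency E"] by (auto simp: sym_def)
  show "trans ((adjacency E)\<^sup>* \<inter> S \<times> S)"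
    by (auto simp: trans_def)
qed (auto simp: refl_on_def)

text \<open>An equivalence relation can be recovered from its classes, so equal CC answers mean
  equal connectivity.\<close>

lemma quotient_eq_imp_subset:
  assumes R: "equiv S R" and R': "equiv S R'" and eq: "S // R = S // R'"
  shows "R \<subseteq> R'"
proof (rule subrelI)
  fix u v assume uv: "(u, v) \<in> R"
  then have "u \<in> S"
    using equiv_class_eq_iff[OF R] by blast
  then have "R `` {u} \<in> S // R'" and "u \<in> R `` {u}"
    using eq quotientI[of u S R] equiv_class_self[OF R] by auto
  then show "(u, v) \<in> R'"
    using uv quotient_eq_iff[OF R', of "R `` {u}" "R `` {u}" u v] by simp
qed

text \<open>In the other graph \<open>u\<close> is still connected to \<open>v\<close>, by a path of
  positive length as they differ; its first edge is the one obtained. All comparisons of CC answers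
  below rest on this.\<close>

lemma cc_answer_eq_imp_edge:
  assumes eq: "cc_answer E S = cc_answer E' S"
    and "{u, v} \<in> E" "{u, v} \<subseteq> S" "u \<noteq> v"
  obtains x where "{u, x} \<in> E'" "x \<in> S"
proof -
  have "(u, v) \<in> (adjacency (induced_edges E S))\<^sup>* \<inter> S \<times> S"
    using assms by (auto simp: adjacency_def induced_edges_def)
  then have "(u, v) \<in> (adjacency (induced_edges E' S))\<^sup>*"
    using quotient_eq_imp_subset[OF equiv_connected equiv_connected] eq
    unfolding cc_answer_def components_def by blast
  then show ?thesis
    using \<open>u \<noteq> v\<close> that
    by (cases rule: converse_rtranclE) (auto simp: adjacency_def induced_edges_def)
qed

section \<open>Recovering an arbitrary graph and certifying a star\<close>

definition pairs :: "nat \<Rightarrow> nat set list" where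
  "pairs n = concat (map (\<lambda>u. map (\<lambda>v. {u, v}) [0..<n]) [0..<n])"

lemma mem_pairs: "e \<in> set (pairs n) \<longleftrightarrow> (\<exists>u<n. \<exists>v<n. e = {u, v})"
  unfolding pairs_def set_concat set_map set_upt UN_iff image_image image_iff Bex_def
  by simp

text \<open>Within a pair, the only possible neighbour of \<open>u\<close> is the other vertex,
  since a simple graph has no loops.\<close>

lemma pairs_determine_graph:
  assumes E: "simple_graph {..<n} E" and E': "simple_graph {..<n} E'"
    and eq: "map (cc_answer E) (pairs n) = map (cc_answer E') (pairs n)"
  shows "E = E'"
proof -
  have "E1 \<subseteq> E2" if E1: "simple_graph {..<n} E1" and E2: "simple_graph {..<n} E2"
    and eq: "\<forall>e\<in>set (pairs n). cc_answer E1 e = cc_answer E2 e" for E1 E2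
  proof
    fix e assume e: "e \<in> E1"
    then obtain u v where uv: "e = {u, v}" "u \<noteq> v" "u < n" "v < n"
      using E1 by (auto simp: simple_graph_def card_2_iff)
    then have "cc_answer E1 e = cc_answer E2 e"
      using eq mem_pairs by blast
    then obtain x where x: "{u, x} \<in> E2" "x \<in> e"
      using cc_answer_eq_imp_edge[of E1 e E2 u v] e uv by auto
    then have "x \<noteq> u"
      using E2 by (auto simp: simple_graph_def)
    then show "e \<in> E2"
      using x uv by auto
  qed
  then show ?thesis
    using E E' eq by (metis map_eq_conv subset_antisym)
qed

lemma star_certificate:
  assumes c: "n = 0 \<or> c < n" and E: "simple_graph {..<n} E"
    and leaves: "cc_answer E ({..<n} - {c}) = cc_answer (star n c) ({..<n} - {c})"
    and connected: "cc_answer E {..<n} = cc_answer (star n c) {..<n}"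
  shows "E = star n c"
proof -
  have edge: "e \<in> star n c" if e: "e \<in> E" for e
  proof -
    obtain u v where uv: "e = {u, v}" "u \<noteq> v" "u < n" "v < n"
      using E e by (auto simp: simple_graph_def card_2_iff)
    have "u = c \<or> v = c"
    proof (rule ccontr)
      assume "\<not> ?thesis"
      then obtain x where "{u, x} \<in> star n c" "x \<in> {..<n} - {c}"
        using cc_answer_eq_imp_edge[OF leaves, of u v] e uv by auto
      then show False
        using \<open>\<not> (u = c \<or> v = c)\<close> by (auto dest: mem_starD)
    qed
    then show ?thesis
      using uv by (auto simp: star_def)
  qed
  moreover have "e \<in> E" if e: "e \<in> star n c" for e
  proof -
    \<comment> \<open>The leaf is named first so that an edge of \<open>E\<close> at
      \<open>v\<close> results; by \<open>edge\<close> it belongs to the star, hence leads to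
      \<open>c\<close>.\<close>
    obtain v where v: "e = {v, c}" "v \<noteq> c" "v < n"
      using e by (auto simp: star_def)
    then obtain x where "{v, x} \<in> E"
      using cc_answer_eq_imp_edge[OF connected[symmetric], of v c] e c by auto
    then show ?thesis
      using v edge mem_starD by metis
  qed
  ultimately show ?thesis
    by blast
qed

section \<open>Locating the centre by its bits\<close>

definition bit_queries :: "nat \<Rightarrow> nat set list" where
  "bit_queries n = concat (map (\<lambda>i. [{v. v < n \<and> bit v i}, {v. v < n \<and> \<not> bit v i}])
     [0..<nat \<lceil>log 2 n\<rceil>])"

lemma length_bit_queries: "length (bit_queries n) = 2 * nat \<lceil>log 2 n\<rceil>"
  by (simp add: bit_queries_def length_concat o_def sum_list_triv)

text \<open>Numbers below \<open>n\<close> are below \<open>2 ^ ?L\<close>, so two different ones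
  differ in one of the first \<open>?L\<close> bits. Naming the sides by \<open>bit u i\<close> and
  \<open>bit v i\<close> keeps \<open>u\<close> and \<open>v\<close> interchangeable.\<close>

lemma bit_queries_separate:
  assumes "u < n" "v < n" "u \<noteq> v"
  obtains i where "{w. w < n \<and> bit w i = bit u i} \<in> set (bit_queries n)"
    and "{w. w < n \<and> bit w i = bit v i} \<in> set (bit_queries n)"
    and "bit u i \<noteq> bit v i"
proof -
  let ?L = "nat \<lceil>log 2 n\<rceil>"
  have "real n = 2 powr log 2 n"
    using assms by simp
  also have "\<dots> \<le> 2 powr ?L"
    by (intro powr_mono real_nat_ceiling_ge) simp
  finally have "n \<le> 2 ^ ?L"
    by (simp add: powr_realpow)
  then have "take_bit ?L u = u" "take_bit ?L v = v"
    using assms by (auto simp: take_bit_nat_eq_self_iff)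
  then obtain i where i: "i < ?L" "bit u i \<noteq> bit v i"
    using \<open>u \<noteq> v\<close> by (metis bit_eq_iff bit_take_bit_iff)
  have "{w. w < n \<and> bit w i = b} \<in> set (bit_queries n)" for b
    using i by (cases b) (auto simp: bit_queries_def)
  then show ?thesis
    using that i by blast
qed

text \<open>The centre \<open>c\<close> is joined to \<open>w\<close> inside \<open>S\<close>,
  whereas no edge of the star at \<open>c'\<close> lies inside \<open>S\<close>.\<close>

lemma cc_answer_star_neq:
  assumes "c \<in> S" "c' \<notin> S" "w \<in> S" "w \<noteq> c" "w < n"
  shows "cc_answer (star n c) S \<noteq> cc_answer (star n c') S"
proof
  assume "cc_answer (star n c) S = cc_answer (star n c') S"
  moreover have "{c, w} \<in> star n c"
    using assms by (auto simp: star_def)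
  ultimately obtain x where "{c, x} \<in> star n c'" "x \<in> S"
    using cc_answer_eq_imp_edge[of "star n c" S "star n c'" c w] assms by auto
  then show False
    using assms by (auto dest: mem_starD)
qed

text \<open>Stars are compared rather than centres, because on two vertices both centres give the
  same star.\<close>

lemma bit_queries_determine_star:
  assumes c: "n = 0 \<or> c < n" and c': "n = 0 \<or> c' < n"
    and eq: "map (cc_answer (star n c)) (bit_queries n) = map (cc_answer (star n c')) (bit_queries n)"
  shows "star n c = star n c'"
proof (cases "c = c' \<or> {..<n} \<subseteq> {c, c'}")
  case True
  then show ?thesis
    using c c' by (auto simp: star_def)
next
  case False
  \<comment> \<open>A query containing a single vertex does not tell whether this is the centre, but a third
    vertex makes one of the two queries for a separating bit large enough.\<close>
  then obtain w where w: "w < n" "w \<noteq> c" "w \<noteq> c'"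
    by auto
  obtain i where i: "{w. w < n \<and> bit w i = bit c i} \<in> set (bit_queries n)"
      "{w. w < n \<and> bit w i = bit c' i} \<in> set (bit_queries n)" "bit c i \<noteq> bit c' i"
    using bit_queries_separate[of c n c'] False c c' w by auto
  have eq': "cc_answer (star n c) S = cc_answer (star n c') S" if "S \<in> set (bit_queries n)" for S
    using eq that by simp
  show ?thesis
  \<comment> \<open>A bit has two values, so \<open>w\<close> lies on the side of \<open>c\<close>
    or on that of \<open>c'\<close>.\<close>
  proof (cases "bit w i = bit c i")
    case True
    then show ?thesis
      using cc_answer_star_neq[of c "{w. w < n \<and> bit w i = bit c i}" c' w n] eq'[OF i(1)] i(3) c w
      by auto
  next
    case False
    then show ?thesis
      using cc_answer_star_neq[of c' "{w. w < n \<and> bit w i = bit c' i}" c w n] eq'[OF i(2)] i(3) c' w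
      by auto
  qed
qed

section \<open>The CC algorithm, its correctness and its cost on stars\<close>

definition star_guess :: "nat \<Rightarrow> nat set set list \<Rightarrow> nat" where
  "star_guess n rs =
     (SOME c. (n = 0 \<or> c < n) \<and> rs = map (cc_answer (star n c)) (bit_queries n))"

definition certificate :: "nat \<Rightarrow> nat \<Rightarrow> nat set list" where
  "certificate n c = [{..<n} - {c}, {..<n}]"

text \<open>The guess is arbitrary when the answers fit no star, so its range is tested as well.\<close>

definition cc_algorithm :: "nat \<Rightarrow> (nat, nat set set) algorithm" where
  "cc_algorithm n = ask (bit_queries n) (\<lambda>rs.
     let c = star_guess n rs in ask (certificate n c) (\<lambda>rs'.
       if (n = 0 \<or> c < n) \<and> rs' = map (cc_answer (star n c)) (certificate n c)
       then Output (star n c)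
       else ask (pairs n) (\<lambda>rs''.
         Output (THE E. simple_graph {..<n} E \<and> rs'' = map (cc_answer E) (pairs n)))))"

text \<open>Correctness does not depend on how the guess arises: a star is output only with its
  certificate, and otherwise the pairs leave \<open>E\<close> as the unique candidate.\<close>

lemma cc_algorithm_solves: "solves_GR cc_oracle {..<n} (cc_algorithm n)"
proof -
  have "queries_within {..<n} (cc_algorithm n)"
    by (auto simp: cc_algorithm_def queries_within_ask Let_def certificate_def mem_pairs bit_queries_def)
  moreover have "F = E" if E: "simple_graph {..<n} E" and run: "run cc_oracle E (cc_algorithm n) q F"
    for E q F
  proof -
    define c where "c = star_guess n (map (cc_answer E) (bit_queries n))"
    have "(THE E'. simple_graph {..<n} E' \<and>
        map (cc_answer E) (pairs n) = map (cc_answer E') (pairs n)) = E"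
      using E pairs_determine_graph by (intro the_equality) auto
    moreover have "E = star n c"
      if "n = 0 \<or> c < n" "map (cc_answer E) (certificate n c) = map (cc_answer (star n c)) (certificate n c)"
      using that star_certificate[OF _ E] by (simp add: certificate_def)
    ultimately show ?thesis
      using run unfolding cc_algorithm_def run_ask_cc Let_def c_def[symmetric]
      by (auto simp: run_ask_cc run_Output_iff simp del: map_eq_conv split: if_splits)
  qed
  ultimately show ?thesis
    by (auto simp: solves_GR_def)
qed

text \<open>The hidden centre shows that a fitting guess exists. Any fitting guess yields the same
  star, so the certificate succeeds and the pairs are never queried.\<close>

lemma cc_algorithm_star:
  assumes c: "n = 0 \<or> c < n"
  shows "uses_at_most cc_oracle (star n c) (cc_algorithm n) (2 * nat \<lceil>log 2 n\<rceil> + 2)"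
proof -
  define c' where "c' = star_guess n (map (cc_answer (star n c)) (bit_queries n))"
  have c': "(n = 0 \<or> c' < n) \<and>
      map (cc_answer (star n c)) (bit_queries n) = map (cc_answer (star n c')) (bit_queries n)"
    unfolding c'_def star_guess_def by (rule someI[of _ c]) (simp add: c)
  then have eq: "star n c = star n c'"
    by (metis bit_queries_determine_star c)
  show ?thesis
    unfolding uses_at_most_def cc_algorithm_def run_ask_cc Let_def c'_def[symmetric]
    using c' by (simp add: eq[symmetric] run_Output_iff length_bit_queries certificate_def)
qed

theorem theorem14:
  "\<exists>\<G>. instance_family \<G> \<and>
     (\<exists>f :: nat \<Rightarrow> nat. (\<lambda>n. real (f n)) \<in> \<Omega>(\<lambda>n. real n) \<and>
        (\<forall>n. \<forall>E\<in>\<G> n. \<forall>A. solves_GR mis_oracle {..<n} A \<longrightarrow>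
           may_need_at_least mis_oracle E A (f n))) \<and>
     (\<exists>g :: nat \<Rightarrow> nat. (\<lambda>n. real (g n)) \<in> O(\<lambda>n. ln (real n)) \<and>
        (\<forall>n. \<exists>A. solves_GR cc_oracle {..<n} A \<and>
           (\<forall>E\<in>\<G> n. uses_at_most cc_oracle E A (g n))))"
proof (intro exI conjI)
  show "instance_family stars"
    by (rule instance_family_stars)
  show "(\<lambda>n. real (n - 1)) \<in> \<Omega>(\<lambda>n. real n)"
  proof (rule landau_omega.bigI)
    show "eventually (\<lambda>n. norm (real (n - 1)) \<ge> 1/2 * norm (real n)) at_top"
      using eventually_ge_at_top[of 2] by eventually_elim simp
  qed simp
  show "\<forall>n. \<forall>E\<in>stars n. \<forall>A. solves_GR mis_oracle {..<n} A \<longrightarrow>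
      may_need_at_least mis_oracle E A (n - 1)"
    using mis_lower_bound by (auto simp: stars_def)
  \<comment> \<open>From \<open>n = 2\<close> on the logarithm is nonnegative, so \<open>nat\<close>
    does not affect the asymptotics.\<close>
  have "(\<lambda>n. real_of_int (2 * \<lceil>log 2 (real n)\<rceil> + 2)) \<in> O(\<lambda>n. ln (real n))"
    by real_asymp
  moreover have "eventually (\<lambda>n. real (2 * nat \<lceil>log 2 (real n)\<rceil> + 2) =
      real_of_int (2 * \<lceil>log 2 (real n)\<rceil> + 2)) at_top"
    using eventually_ge_at_top[of 2] by eventually_elim simp
  ultimately show "(\<lambda>n. real (2 * nat \<lceil>log 2 (real n)\<rceil> + 2)) \<in> O(\<lambda>n. ln (real n))"
    by (subst landau_o.big.in_cong)
  show "\<forall>n. \<exists>A. solves_GR cc_oracle {..<n} A \<and>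
      (\<forall>E\<in>stars n. uses_at_most cc_oracle E A (2 * nat \<lceil>log 2 (real n)\<rceil> + 2))"
    using cc_algorithm_solves cc_algorithm_star unfolding stars_def by blast
qed

end
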